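(* Let $r\ge 2$. Suppose the edges of $K_n$ are $r$-colored and, for each $i\in[r]$, let $G_i$ be the graph on the $n$ vertices whose edges are those of color $i$. Then $$\sum_{i=1}^r k(G_i)\le (r-1)(n+1)+2^n .$$ Moreover, this bound is achieved when $G_i=K_n$ for some $i\in[r]$.
   Context: $[r]=\{1,\dots,r\}$. An $r$-coloring assigns each edge of $K_n$ exactly one color in $[r]$ (colors may be unused). $k(G)$ is the number of cliques of $G$, i.e. vertex subsets inducing a complete subgraph; the empty set and all singletons count as cliques. *)

theory Defs
  imports Complex_Main "HOL-Library.Ramsey" "HOL-Library.FuncSet"
begin

text \<open>A simple graph is given by a vertex set and a set of two-element vertex sets; the complete
  graph on \<open>V\<close> has edge set \<open>nsets V 2\<close>. Cliques are those of \<^const>\<open>Ramsey.clique\<close>, under which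
  the empty set and all singletons are cliques.\<close>

definition num_cliques :: "'a set \<Rightarrow> 'a set set \<Rightarrow> nat" where
  "num_cliques V E = card {S. S \<subseteq> V \<and> Ramsey.clique S E}"

text \<open>Colours need not be used.\<close>

definition edge_coloring :: "nat \<Rightarrow> 'a set \<Rightarrow> ('a set \<Rightarrow> nat) \<Rightarrow> bool" where
  "edge_coloring r V c \<longleftrightarrow> c \<in> nsets V 2 \<rightarrow> {1..r}"

definition color_class :: "'a set \<Rightarrow> ('a set \<Rightarrow> nat) \<Rightarrow> nat \<Rightarrow> 'a set set" where
  "color_class V c i = {e \<in> nsets V 2. c e = i}"

end

theory Submission
  imports Defs
begin

text \<open>A clique with at least two vertices contains an edge and therefore belongs to at most one
  colour class, while each of the \<open>n + 1\<close> vertex sets of size at most one is a clique in all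
  \<open>r\<close> of them.\<close>

definition trivial_subsets :: "'a set \<Rightarrow> 'a set set" where
  "trivial_subsets V = insert {} ((\<lambda>v. {v}) ` V)"

definition nontrivial_cliques :: "'a set \<Rightarrow> 'a set set \<Rightarrow> 'a set set" where
  "nontrivial_cliques V E = {S. S \<subseteq> V \<and> Ramsey.clique S E} - trivial_subsets V"

lemma trivial_subsets_subset_Pow: "trivial_subsets V \<subseteq> Pow V"
  by (auto simp: trivial_subsets_def)

lemma card_trivial_subsets:
  assumes "finite V"
  shows "card (trivial_subsets V) = card V + 1"
proof -
  have "card ((\<lambda>v. {v}) ` V) = card V"
    by (rule card_image) (simp add: inj_on_def)
  moreover have "{} \<notin> (\<lambda>v. {v}) ` V" by auto
  ultimately show ?thesis
    using assms by (simp add: trivial_subsets_def)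
qed

lemma card_Pow_diff_trivial_subsets:
  assumes "finite V"
  shows "card (Pow V - trivial_subsets V) + (card V + 1) = 2 ^ card V"
proof -
  have "card (Pow V) = card (Pow V - trivial_subsets V) + card (trivial_subsets V)"
    using assms trivial_subsets_subset_Pow[of V]
    by (metis card_Diff_subset card_mono finite_Pow_iff finite_subset le_add_diff_inverse2)
  then show ?thesis
    using assms by (simp add: card_Pow card_trivial_subsets)
qed

text \<open>The clique condition is vacuous on sets with at most one vertex, so their contribution
  is the same for every \<open>E\<close>; only the second summand depends on the graph.\<close>

lemma num_cliques_eq:
  assumes "finite V"
  shows "num_cliques V E = (card V + 1) + card (nontrivial_cliques V E)"
proof -
  let ?C = "{S. S \<subseteq> V \<and> Ramsey.clique S E}"
  have "finite ?C" using assms by simp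
  moreover have "trivial_subsets V \<subseteq> ?C"
    by (auto simp: trivial_subsets_def Ramsey.clique_def)
  ultimately have "card ?C = card (trivial_subsets V) + card (nontrivial_cliques V E)"
    unfolding nontrivial_cliques_def
    by (metis card_Diff_subset card_mono finite_subset le_add_diff_inverse)
  then show ?thesis
    using assms by (simp add: num_cliques_def card_trivial_subsets)
qed

text \<open>Removing \<open>trivial_subsets V\<close> leaves sets with two distinct vertices, and
  the clique condition joins them. This edge is what ties a nontrivial clique to a single
  colour.\<close>

lemma nontrivial_clique_edge:
  assumes "S \<in> nontrivial_cliques V E"
  obtains v w where "v \<in> S" "w \<in> S" "v \<noteq> w" "{v, w} \<in> E"
proof -
  have S: "S \<subseteq> V" "Ramsey.clique S E" "S \<notin> trivial_subsets V"
    using assms by (auto simp: nontrivial_cliques_def)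
  then obtain v where v: "v \<in> S" by (auto simp: trivial_subsets_def)
  with S have "S \<noteq> {v}" by (auto simp: trivial_subsets_def)
  with v obtain w where "w \<in> S" "v \<noteq> w" by auto
  with v S(2) that show thesis by (auto simp: Ramsey.clique_def)
qed

text \<open>A shared nontrivial clique would have an edge in \<open>E\<close>, and being a clique
  for \<open>F\<close> too, it would force that same edge into \<open>F\<close>.\<close>

lemma disjoint_nontrivial_cliques:
  assumes "E \<inter> F = {}"
  shows "nontrivial_cliques V E \<inter> nontrivial_cliques V F = {}"
proof (rule ccontr)
  assume "\<not> ?thesis"
  then obtain S where S: "S \<in> nontrivial_cliques V E" "S \<in> nontrivial_cliques V F" by auto
  from S(1) obtain v w where vw: "v \<in> S" "w \<in> S" "v \<noteq> w" "{v, w} \<in> E"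
    by (rule nontrivial_clique_edge)
  with S(2) have "{v, w} \<in> F"
    by (auto simp: nontrivial_cliques_def Ramsey.clique_def)
  with vw assms show False by auto
qed

text \<open>Needed for the equality case, where one colour class is the complete graph.\<close>

lemma nontrivial_cliques_complete:
  "nontrivial_cliques V (nsets V 2) = Pow V - trivial_subsets V"
proof -
  have "Ramsey.clique S (nsets V 2)" if "S \<subseteq> V" for S
    using that by (auto simp: Ramsey.clique_def nsets_def)
  then show ?thesis by (auto simp: nontrivial_cliques_def)
qed

text \<open>Distinct colour classes share no edge because \<open>c\<close> is a function, so their
  families of nontrivial cliques are disjoint and the sizes add up to that of the union. Bounding
  the sum thus becomes bounding one family of subsets of \<open>V\<close>.\<close>

lemma sum_num_cliques_color_class:
  assumes "finite V"
  shows "(\<Sum>i\<in>{1..r}. num_cliques V (color_class V c i))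
    = r * (card V + 1) + card (\<Union>i\<in>{1..r}. nontrivial_cliques V (color_class V c i))"
proof -
  have fin: "finite (nontrivial_cliques V E)" for E
    using assms by (simp add: nontrivial_cliques_def)
  have "card (\<Union>i\<in>{1..r}. nontrivial_cliques V (color_class V c i))
      = (\<Sum>i\<in>{1..r}. card (nontrivial_cliques V (color_class V c i)))"
    by (intro card_UN_disjoint ballI impI disjoint_nontrivial_cliques)
      (auto simp: fin color_class_def)
  then show ?thesis
    using assms by (simp only: num_cliques_eq sum.distrib) simp
qed

theorem proposition1p9:
  fixes r n :: nat and V :: "'a set" and c :: "'a set \<Rightarrow> nat"
  assumes "r \<ge> 2"
    and "finite V" and "card V = n"
    and "edge_coloring r V c"
  shows "(\<Sum>i\<in>{1..r}. num_cliques V (color_class V c i)) \<le> (r - 1) * (n + 1) + 2 ^ n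
    \<and> ((\<exists>i\<in>{1..r}. color_class V c i = nsets V 2) \<longrightarrow>
        (\<Sum>i\<in>{1..r}. num_cliques V (color_class V c i)) = (r - 1) * (n + 1) + 2 ^ n)"
proof -
  let ?U = "\<Union>i\<in>{1..r}. nontrivial_cliques V (color_class V c i)"
  let ?P = "Pow V - trivial_subsets V"
  have U: "?U \<subseteq> ?P" by (auto simp: nontrivial_cliques_def)
  \<comment> \<open>One of the \<open>r\<close> copies of \<open>n + 1\<close> is split off: added
    to \<open>card ?U\<close>, it gives the quantity to compare with \<open>2 ^ n\<close>. Truncated
    subtraction is harmless since \<open>r\<close> is positive.\<close>
  have "r * (n + 1) = (r - 1) * (n + 1) + (n + 1)"
    using assms(1) by (cases r) simp_all
  then have sum: "(\<Sum>i\<in>{1..r}. num_cliques V (color_class V c i))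
      = (r - 1) * (n + 1) + (card ?U + (n + 1))"
    by (simp only: sum_num_cliques_color_class[OF assms(2)] assms(3) ac_simps)
  have P: "card ?P + (n + 1) = 2 ^ n"
    using card_Pow_diff_trivial_subsets[OF assms(2)] assms(3) by simp
  have "card ?U \<le> card ?P"
    using U assms(2) by (intro card_mono) auto
  moreover have "?U = ?P" if "\<exists>i\<in>{1..r}. color_class V c i = nsets V 2"
  proof (rule equalityI[OF U])
    from that obtain i where "i \<in> {1..r}" "color_class V c i = nsets V 2" by blast
    \<comment> \<open>The complete colour class \<open>i\<close> alone already supplies all of
      \<open>?P\<close>.\<close>
    then show "?P \<subseteq> ?U"
      using nontrivial_cliques_complete[of V] by (intro subset_trans[OF _ UN_upper[of i]]) auto
  qed
  \<comment> \<open>Rewriting \<open>2 ^ n\<close> as \<open>card ?P + (n + 1)\<close> makes both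
    sides differ only in \<open>card ?U\<close> versus \<open>card ?P\<close>.\<close>
  ultimately show ?thesis
    unfolding sum P[symmetric] by auto
qed

end
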